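(* (Sufficient optimality conditions) Consider the gauge optimization problem (P) and its dual (D) defined in the context. Points $x^*\in\mathbb{R}^n$ and $(u^*,v^* )\in\mathbb{R}^k\times\mathbb{R}^\ell$ are optimal for (P) and (D), respectively, if the following conditions hold: (i) (primal feasibility) $Hx^*+K\mathcal{G}(x^* )\le p$, $Ax^*=b$, $x^*\in\mathrm{dom}\,\mathcal{G}$; (ii) (dual feasibility) $\mathcal{G}^\circ(A^Tu^*-H^Tv^*-c)-K^Tv^*\le d$, $v^*\ge 0$; (iii) (complementarity) $\left[d+K^Tv^*-\mathcal{G}^\circ(A^Tu^*-H^Tv^*-c)\right]_i\, g_i(x^*_{I_i})=0$ for $i=1,\dots,m$; (iv) (complementarity) $\left[p-Hx^*-K\mathcal{G}(x^* )\right]_i\, v_i^*=0$ for $i=1,\dots,\ell$; (v) (alignment) $\mathcal{G}^\circ(A^Tu^*-H^Tv^*-c)^T\mathcal{G}(x^* )=(A^Tu^*-H^Tv^*-c)^Tx^*$.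
   Context: Vector inequalities are componentwise and $[\cdot]_i$ denotes the $i$-th component. The index set $\{1,\dots,n\}$ is partitioned into pairwise disjoint sets $I_1,\dots,I_m$ with $\#I_i=n_i$, $n=n_1+\cdots+n_m$; $x_{I_i}\in\mathbb{R}^{n_i}$ is the corresponding subvector of $x\in\mathbb{R}^n$. A gauge function is a function $g:\mathbb{R}^q\to\mathbb{R}\cup\{\infty\}$ that is convex, nonnegative, positively homogeneous ($g(\lambda x)=\lambda g(x)$ for all $x$ and $\lambda>0$) and satisfies $g(0)=0$. A vector gauge function is $\mathcal{G}(x)=(g_1(x_{I_1}),\dots,g_m(x_{I_m}))^T$ with each $g_i:\mathbb{R}^{n_i}\to\mathbb{R}\cup\{\infty\}$ a gauge function; $\mathrm{dom}\,\mathcal{G}=\{x : g_i(x_{I_i})<\infty,\ i=1,\dots,m\}$. The polar of $g_i$ is $g_i^\circ(y)=\sup\{x^Ty : g_i(x)\le 1\}$, and $\mathcal{G}^\circ(y)=(g_1^\circ(y_{I_1}),\dots,g_m^\circ(y_{I_m}))^T$. Given $c\in\mathbb{R}^n$, $d\in\mathbb{R}^m$, $b\in\mathbb{R}^k$, $p\in\mathbb{R}^\ell$, $A\in\mathbb{R}^{k\times n}$, $H\in\mathbb{R}^{\ell\times n}$, $K\in\mathbb{R}^{\ell\times m}$ and a vector gauge function $\mathcal{G}$: (P): minimize $c^Tx+d^T\mathcal{G}(x)$ subject to $Ax=b$, $Hx+K\mathcal{G}(x)\le p$, $x\in\mathrm{dom}\,\mathcal{G}$. (D): maximize $b^Tu-p^Tv$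 over $(u,v)\in\mathbb{R}^k\times\mathbb{R}^\ell$ subject to $\mathcal{G}^\circ(A^Tu-H^Tv-c)-K^Tv\le d$, $v\ge 0$. No sign assumption on $d$ or $K$ and no constraint qualification is made. *)

theory Defs
  imports
    "HOL-Library.Extended_Real"
    "HOL-Library.Disjoint_Sets"
    "Jordan_Normal_Form.Matrix"
    "Jordan_Normal_Form.DL_Missing_Sublist"
begin

(* R^q is carrier_vec q, and the values R \<union> {\<infinity>} are modelled in ereal; nonnegativity
   excludes -\<infinity>.  Convexity is only required for 0 < t < 1, so that the convention
   0 * \<infinity> = 0 plays no role. *)
definition gauge_function :: "nat \<Rightarrow> (real vec \<Rightarrow> ereal) \<Rightarrow> bool" where
  "gauge_function q g \<longleftrightarrow>
     (\<forall>x\<in>carrier_vec q. \<forall>y\<in>carrier_vec q. \<forall>t::real. 0 < t \<and> t < 1 \<longrightarrow>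
        g (t \<cdot>\<^sub>v x + (1 - t) \<cdot>\<^sub>v y) \<le> ereal t * g x + ereal (1 - t) * g y) \<and>
     (\<forall>x\<in>carrier_vec q. 0 \<le> g x) \<and>
     (\<forall>x\<in>carrier_vec q. \<forall>r::real. 0 < r \<longrightarrow> g (r \<cdot>\<^sub>v x) = ereal r * g x) \<and>
     g (0\<^sub>v q) = 0"

definition polar :: "nat \<Rightarrow> (real vec \<Rightarrow> ereal) \<Rightarrow> real vec \<Rightarrow> ereal" where
  "polar q g y = (SUP x \<in> {x \<in> carrier_vec q. g x \<le> 1}. ereal (x \<bullet> y))"

(* The entries of x indexed by J, in increasing order of the index (pick J j is the j-th
   element of J, counted from 0). *)
definition subvector :: "real vec \<Rightarrow> nat set \<Rightarrow> real vec" where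
  "subvector x J = vec (card J) (\<lambda>j. x $ pick J j)"

definition index_partition :: "nat \<Rightarrow> nat \<Rightarrow> (nat \<Rightarrow> nat set) \<Rightarrow> bool" where
  "index_partition n m I \<longleftrightarrow> disjoint_family_on I {..<m} \<and> (\<Union>i<m. I i) = {..<n}"

definition vector_gauge ::
    "nat \<Rightarrow> (nat \<Rightarrow> nat set) \<Rightarrow> (nat \<Rightarrow> real vec \<Rightarrow> ereal) \<Rightarrow> real vec \<Rightarrow> ereal vec" where
  "vector_gauge m I g x = vec m (\<lambda>i. g i (subvector x (I i)))"

definition vector_polar ::
    "nat \<Rightarrow> (nat \<Rightarrow> nat set) \<Rightarrow> (nat \<Rightarrow> real vec \<Rightarrow> ereal) \<Rightarrow> real vec \<Rightarrow> ereal vec" where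
  "vector_polar m I g y = vec m (\<lambda>i. polar (card (I i)) (g i) (subvector y (I i)))"

definition gauge_dom ::
    "nat \<Rightarrow> nat \<Rightarrow> (nat \<Rightarrow> nat set) \<Rightarrow> (nat \<Rightarrow> real vec \<Rightarrow> ereal) \<Rightarrow> real vec set" where
  "gauge_dom n m I g = {x \<in> carrier_vec n. \<forall>i<m. g i (subvector x (I i)) < \<infinity>}"

(* Since real_of_ereal \<infinity> = 0, this is to be used only for vectors with finite entries. *)
abbreviation real_vec :: "ereal vec \<Rightarrow> real vec" where
  "real_vec \<equiv> map_vec real_of_ereal"

definition primal_feasible ::
    "nat \<Rightarrow> nat \<Rightarrow> (nat \<Rightarrow> nat set) \<Rightarrow> (nat \<Rightarrow> real vec \<Rightarrow> ereal) \<Rightarrow>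
     real mat \<Rightarrow> real vec \<Rightarrow> real mat \<Rightarrow> real mat \<Rightarrow> real vec \<Rightarrow> real vec \<Rightarrow> bool" where
  "primal_feasible n m I g A b H K p x \<longleftrightarrow>
     x \<in> gauge_dom n m I g \<and>
     A *\<^sub>v x = b \<and>
     H *\<^sub>v x + K *\<^sub>v real_vec (vector_gauge m I g x) \<le> p"

definition primal_objective ::
    "nat \<Rightarrow> (nat \<Rightarrow> nat set) \<Rightarrow> (nat \<Rightarrow> real vec \<Rightarrow> ereal) \<Rightarrow>
     real vec \<Rightarrow> real vec \<Rightarrow> real vec \<Rightarrow> real" where
  "primal_objective m I g c d x = c \<bullet> x + d \<bullet> real_vec (vector_gauge m I g x)"

definition dual_arg ::
    "real mat \<Rightarrow> real mat \<Rightarrow> real vec \<Rightarrow> real vec \<Rightarrow> real vec \<Rightarrow> real vec" where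
  "dual_arg A H c u v = A\<^sup>T *\<^sub>v u - H\<^sup>T *\<^sub>v v - c"

(* The first inequality is between extended real vectors; as d is finite, it forces the entries of
   the polar to be finite. *)
definition dual_feasible ::
    "nat \<Rightarrow> nat \<Rightarrow> nat \<Rightarrow> (nat \<Rightarrow> nat set) \<Rightarrow> (nat \<Rightarrow> real vec \<Rightarrow> ereal) \<Rightarrow>
     real mat \<Rightarrow> real mat \<Rightarrow> real mat \<Rightarrow> real vec \<Rightarrow> real vec \<Rightarrow> real vec \<times> real vec \<Rightarrow> bool" where
  "dual_feasible m k l I g A H K c d = (\<lambda>(u, v).
     u \<in> carrier_vec k \<and> v \<in> carrier_vec l \<and>
     vector_polar m I g (dual_arg A H c u v) - map_vec ereal (K\<^sup>T *\<^sub>v v) \<le> map_vec ereal d \<and>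
     0\<^sub>v l \<le> v)"

definition dual_objective :: "real vec \<Rightarrow> real vec \<Rightarrow> real vec \<times> real vec \<Rightarrow> real" where
  "dual_objective b p = (\<lambda>(u, v). b \<bullet> u - p \<bullet> v)"

end

(* Weak duality with an explicit gap: for primal feasible y and dual feasible (s,t), with
   w = A^T s - H^T t - c, the difference of the objectives equals
   [d + K^T t - G^o(w)]^T G(y) + [p - H y - K G(y)]^T t + (G^o(w)^T G(y) - w^T y).
   All three terms are nonnegative (the last one by the Cauchy-Schwarz inequality for polar gauges),
   and (iii)-(v) say that they vanish at (x,u,v). *)
theory Submission
  imports Defs
begin

text \<open>The zero vector lies in the unit ball of \<open>g\<close>, since \<open>g\<close>
  vanishes there, and it contributes the value 0 to the supremum.\<close>

lemma polar_nonneg: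
  assumes "gauge_function q g" "y \<in> carrier_vec q"
  shows "0 \<le> polar q g y"
proof -
  have "ereal (0\<^sub>v q \<bullet> y) \<le> polar q g y"
    unfolding polar_def using assms by (intro SUP_upper) (auto simp: gauge_function_def)
  then show ?thesis using assms by (simp add: zero_ereal_def)
qed

text \<open>Positive homogeneity allows \<open>x\<close> to be rescaled into the unit ball of
  \<open>g\<close>, where the supremum defining the polar bounds the scalar product. If
  \<open>g x\<close> is positive, scaling by its inverse suffices; if \<open>g x\<close> is 0, the
  whole ray through \<open>x\<close> lies in the ball, and the finite polar keeps
  \<open>x \<bullet> y\<close> from being positive.\<close>

lemma gauge_polar_cauchy_schwarz:
  assumes g: "gauge_function q g" and x: "x \<in> carrier_vec q" and y: "y \<in> carrier_vec q"
    and gx: "g x < \<infinity>" and polar_finite: "polar q g y < \<infinity>"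
  shows "x \<bullet> y \<le> real_of_ereal (polar q g y) * real_of_ereal (g x)"
proof -
  have hom: "g (r \<cdot>\<^sub>v x) = ereal r * g x" if "0 < r" for r
    using g x that by (simp add: gauge_function_def)
  have nonneg: "0 \<le> g x"
    using g x by (simp add: gauge_function_def)
  have upper: "ereal (z \<bullet> y) \<le> polar q g y" if "z \<in> carrier_vec q" "g z \<le> 1" for z
    unfolding polar_def using that by (intro SUP_upper) auto
  obtain P where P: "polar q g y = ereal P" "0 \<le> P"
    using polar_nonneg[OF g y] polar_finite by (cases "polar q g y") auto
  obtain a where a: "g x = ereal a" "0 \<le> a"
    using gx nonneg by (cases "g x") auto
  have scaled: "r * (x \<bullet> y) \<le> P" if "0 < r" "r * a \<le> 1" for r
    using upper[of "r \<cdot>\<^sub>v x"] that x y hom[of r] a P by (simp add: one_ereal_def)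
  show ?thesis
  proof (cases "a = 0")
    case True
    have "x \<bullet> y \<le> 0"
    proof (rule ccontr)
      assume "\<not> x \<bullet> y \<le> 0"
      \<comment> \<open>This factor is positive and turns the left side of \<open>scaled\<close>
        into \<open>P + 1\<close>, which exceeds \<open>P\<close>.\<close>
      then show False
        using scaled[of "(P + 1) / (x \<bullet> y)"] True P(2) by (simp add: zero_less_divide_iff)
    qed
    then show ?thesis using True a P by simp
  next
    case False
    then show ?thesis using scaled[of "1 / a"] a P by (simp add: field_simps)
  qed
qed

text \<open>\<open>pick J\<close> is strictly increasing below \<open>card J\<close> and takes its
  values in \<open>J\<close>, so counting makes it onto. It serves to turn sums over positions of a
  subvector into sums over the original indices.\<close>

lemma bij_betw_pick:
  assumes "finite J"
  shows "bij_betw (pick J) {..<card J} J"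
proof -
  have inj: "inj_on (pick J) {..<card J}"
  proof (rule linorder_inj_onI)
    fix i j assume "i < j" "i \<in> {..<card J}" "j \<in> {..<card J}"
    then show "pick J i \<noteq> pick J j"
      using pick_mono[of j J i] by auto
  qed auto
  have "pick J ` {..<card J} \<subseteq> J"
    by (auto intro: pick_in_set)
  then have "pick J ` {..<card J} = J"
    using assms by (simp add: card_image card_subset_eq inj)
  with inj show ?thesis by (simp add: bij_betw_def)
qed

lemma subvector_carrier: "subvector x J \<in> carrier_vec (card J)"
  by (simp add: subvector_def)

lemma scalar_prod_subvector:
  assumes "finite J"
  shows "subvector x J \<bullet> subvector y J = (\<Sum>i\<in>J. x $ i * y $ i)"
  using sum.reindex_bij_betw[OF bij_betw_pick[OF assms], of "\<lambda>i. x $ i * y $ i"]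
  by (simp add: subvector_def scalar_prod_def atLeast0LessThan)

text \<open>The sum over all indices is regrouped by blocks. The product \<open>\<bullet>\<close>
  sums up to the dimension of its right factor, hence the carrier condition on
  \<open>y\<close>.\<close>

lemma scalar_prod_partition:
  assumes part: "index_partition n m I" and y: "y \<in> carrier_vec n"
  shows "x \<bullet> y = (\<Sum>i<m. subvector x (I i) \<bullet> subvector y (I i))"
proof -
  have disj: "disjoint_family_on I {..<m}" and un: "(\<Union>i<m. I i) = {..<n}"
    using part by (auto simp: index_partition_def)
  have fin: "finite (I i)" if "i < m" for i
    using un that by (metis UN_upper finite_lessThan finite_subset lessThan_iff)
  have "x \<bullet> y = (\<Sum>j\<in>(\<Union>i<m. I i). x $ j * y $ j)"
    using y by (simp add: scalar_prod_def un atLeast0LessThan)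
  also have "\<dots> = (\<Sum>i<m. \<Sum>j\<in>I i. x $ j * y $ j)"
    using disj fin by (intro sum.UNION_disjoint) (auto simp: disjoint_family_on_def)
  finally show ?thesis by (simp add: scalar_prod_subvector fin)
qed

lemma vector_gauge_polar_cauchy_schwarz:
  assumes part: "index_partition n m I"
    and g: "\<And>i. i < m \<Longrightarrow> gauge_function (card (I i)) (g i)"
    and x: "x \<in> gauge_dom n m I g"
    and polar_finite: "\<And>i. i < m \<Longrightarrow> vector_polar m I g w $ i < \<infinity>"
  shows "w \<bullet> x \<le> real_vec (vector_polar m I g w) \<bullet> real_vec (vector_gauge m I g x)"
proof -
  have "w \<bullet> x = (\<Sum>i<m. subvector w (I i) \<bullet> subvector x (I i))"
    using x by (intro scalar_prod_partition[OF part]) (simp add: gauge_dom_def)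
  \<comment> \<open>The factors are swapped because \<open>polar\<close> pairs the argument of the
    gauge on the left with the polar variable on the right.\<close>
  also have "\<dots> = (\<Sum>i<m. subvector x (I i) \<bullet> subvector w (I i))"
    by (intro sum.cong refl comm_scalar_prod[OF subvector_carrier subvector_carrier])
  also have "\<dots> \<le> (\<Sum>i<m. real_of_ereal (polar (card (I i)) (g i) (subvector w (I i)))
                      * real_of_ereal (g i (subvector x (I i))))"
    using g x polar_finite
    by (intro sum_mono gauge_polar_cauchy_schwarz)
      (auto simp: subvector_carrier gauge_dom_def vector_polar_def)
  also have "\<dots> = real_vec (vector_polar m I g w) \<bullet> real_vec (vector_gauge m I g x)"
    by (simp add: scalar_prod_def vector_polar_def vector_gauge_def atLeast0LessThan)
  finally show ?thesis .
qed

text \<open>This is linear algebra only: \<open>P\<close> and \<open>G\<close> are arbitrary vectors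
  standing for the polar and gauge values. On the right, the terms in \<open>P\<close>,
  \<open>H\<close> and \<open>K\<close> cancel in pairs.\<close>

lemma duality_gap:
  fixes A H K :: "real mat" and c d p x u v P G :: "real vec"
  assumes [simp]: "c \<in> carrier_vec n" "d \<in> carrier_vec m" "p \<in> carrier_vec l"
    "A \<in> carrier_mat k n" "H \<in> carrier_mat l n" "K \<in> carrier_mat l m"
    "x \<in> carrier_vec n" "u \<in> carrier_vec k" "v \<in> carrier_vec l"
    "P \<in> carrier_vec m" "G \<in> carrier_vec m"
  shows "(c \<bullet> x + d \<bullet> G) - ((A *\<^sub>v x) \<bullet> u - p \<bullet> v)
    = (d + K\<^sup>T *\<^sub>v v - P) \<bullet> G + (p - H *\<^sub>v x - K *\<^sub>v G) \<bullet> v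
      + (P \<bullet> G - dual_arg A H c u v \<bullet> x)"
proof -
  have [simp]: "K\<^sup>T *\<^sub>v v \<in> carrier_vec m" "A\<^sup>T *\<^sub>v u \<in> carrier_vec n"
    "H\<^sup>T *\<^sub>v v \<in> carrier_vec n" "H *\<^sub>v x \<in> carrier_vec l" "K *\<^sub>v G \<in> carrier_vec l"
    "A *\<^sub>v x \<in> carrier_vec k"
    using mult_mat_vec_carrier[of "K\<^sup>T" m l v] mult_mat_vec_carrier[of "A\<^sup>T" n k u]
      mult_mat_vec_carrier[of "H\<^sup>T" n l v] mult_mat_vec_carrier[of H l n x]
      mult_mat_vec_carrier[of K l m G] mult_mat_vec_carrier[of A k n x]
    by simp_all
  \<comment> \<open>Moving every transpose across the product expresses both sides in the same
    scalar products.\<close>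
  have adjoint: "(M\<^sup>T *\<^sub>v s) \<bullet> y = (M *\<^sub>v y) \<bullet> s"
    if "M \<in> carrier_mat r q" "y \<in> carrier_vec q" "s \<in> carrier_vec r"
    for M :: "real mat" and y s r q
    using transpose_vec_mult_scalar[OF that] that
    by (metis mult_mat_vec_carrier comm_scalar_prod)
  show ?thesis
    unfolding dual_arg_def
    by (simp add: add_scalar_prod_distrib[of _ m] minus_scalar_prod_distrib[of _ m]
        minus_scalar_prod_distrib[of _ l] minus_scalar_prod_distrib[of _ n]
        adjoint[of K l m] adjoint[of A k n] adjoint[of H l n])
qed

lemma scalar_prod_nonneg:
  fixes a b :: "real vec"
  assumes "b \<in> carrier_vec q" "\<And>i. i < q \<Longrightarrow> 0 \<le> a $ i" "\<And>i. i < q \<Longrightarrow> 0 \<le> b $ i"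
  shows "0 \<le> a \<bullet> b"
  using assms by (auto simp: scalar_prod_def intro!: sum_nonneg)


theorem theorem4:
  fixes n m k l :: nat
    and I :: "nat \<Rightarrow> nat set"
    and g :: "nat \<Rightarrow> real vec \<Rightarrow> ereal"
    and c d b p :: "real vec"
    and A H K :: "real mat"
    and x u v :: "real vec"
  assumes "index_partition n m I"
    and "\<And>i. i < m \<Longrightarrow> gauge_function (card (I i)) (g i)"
    and "c \<in> carrier_vec n" "d \<in> carrier_vec m" "b \<in> carrier_vec k" "p \<in> carrier_vec l"
    and "A \<in> carrier_mat k n" "H \<in> carrier_mat l n" "K \<in> carrier_mat l m"
    and "x \<in> carrier_vec n" "u \<in> carrier_vec k" "v \<in> carrier_vec l"
    and primal_feasibility: "primal_feasible n m I g A b H K p x"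
    and dual_feasibility: "dual_feasible m k l I g A H K c d (u, v)"
    and complementarity_gauge: "\<And>i. i < m \<Longrightarrow>
      (d + K\<^sup>T *\<^sub>v v - real_vec (vector_polar m I g (dual_arg A H c u v))) $ i
        * real_of_ereal (g i (subvector x (I i))) = 0"
    and complementarity_ineq: "\<And>i. i < l \<Longrightarrow>
      (p - H *\<^sub>v x - K *\<^sub>v real_vec (vector_gauge m I g x)) $ i * v $ i = 0"
    and alignment:
      "real_vec (vector_polar m I g (dual_arg A H c u v)) \<bullet> real_vec (vector_gauge m I g x)
        = dual_arg A H c u v \<bullet> x"
  shows "is_arg_min (primal_objective m I g c d) (primal_feasible n m I g A b H K p) x
    \<and> is_arg_max (dual_objective b p) (dual_feasible m k l I g A H K c d) (u, v)"
proof -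
  let ?G = "\<lambda>y. real_vec (vector_gauge m I g y)"
  let ?P = "\<lambda>s t. real_vec (vector_polar m I g (dual_arg A H c s t))"
  have G_carrier: "?G y \<in> carrier_vec m" for y
    by (simp add: vector_gauge_def)
  have P_carrier: "?P s t \<in> carrier_vec m" for s t
    by (simp add: vector_polar_def)
  have gap: "primal_objective m I g c d y - dual_objective b p (s, t)
      = (d + K\<^sup>T *\<^sub>v t - ?P s t) \<bullet> ?G y + (p - H *\<^sub>v y - K *\<^sub>v ?G y) \<bullet> t
        + (?P s t \<bullet> ?G y - dual_arg A H c s t \<bullet> y)"
    if "A *\<^sub>v y = b" "y \<in> carrier_vec n" "s \<in> carrier_vec k" "t \<in> carrier_vec l" for y s t
    using duality_gap[OF assms(3,4,6-9) that(2-4) P_carrier[of s t] G_carrier[of y]] that(1)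
    by (simp add: primal_objective_def dual_objective_def)
  have weak: "dual_objective b p (s, t) \<le> primal_objective m I g c d y"
    if y: "primal_feasible n m I g A b H K p y"
      and st: "dual_feasible m k l I g A H K c d (s, t)" for y s t
  proof -
    from y have dom: "y \<in> gauge_dom n m I g" and yc: "y \<in> carrier_vec n"
      and Ay: "A *\<^sub>v y = b" and ineq: "H *\<^sub>v y + K *\<^sub>v ?G y \<le> p"
      by (auto simp: primal_feasible_def gauge_dom_def)
    from st have sc: "s \<in> carrier_vec k" and tc: "t \<in> carrier_vec l" and t0: "0\<^sub>v l \<le> t"
      and dual: "vector_polar m I g (dual_arg A H c s t) - map_vec ereal (K\<^sup>T *\<^sub>v t)
        \<le> map_vec ereal d"
      by (auto simp: dual_feasible_def)
    have polar_le: "vector_polar m I g (dual_arg A H c s t) $ i - ereal ((K\<^sup>T *\<^sub>v t) $ i)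
        \<le> ereal (d $ i)" if "i < m" for i
      using dual that assms(4,9) by (auto simp: less_eq_vec_def)
    \<comment> \<open>An infinite entry would stay infinite after subtracting a real number and
      exceed \<open>d $ i\<close>. Finiteness matters because \<open>real_of_ereal\<close> sends
      infinity to 0.\<close>
    have finite: "vector_polar m I g (dual_arg A H c s t) $ i < \<infinity>" if "i < m" for i
      using polar_le[OF that]
      by (cases "vector_polar m I g (dual_arg A H c s t) $ i") auto
    have polar_ge_0: "0 \<le> vector_polar m I g (dual_arg A H c s t) $ i" if "i < m" for i
      using that polar_nonneg[OF assms(2) subvector_carrier] by (simp add: vector_polar_def)
    have "0 \<le> (d + K\<^sup>T *\<^sub>v t - ?P s t) \<bullet> ?G y"
    proof (rule scalar_prod_nonneg[OF G_carrier])
      fix i assume i: "i < m"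
      show "0 \<le> ?G y $ i"
        using i assms(2)[OF i]
        by (simp add: vector_gauge_def gauge_function_def subvector_carrier real_of_ereal_pos)
      show "0 \<le> (d + K\<^sup>T *\<^sub>v t - ?P s t) $ i"
        \<comment> \<open>The two bounds rule out both infinite cases; in the real case
          \<open>polar_le\<close> is the claim rearranged.\<close>
        using polar_le[OF i] polar_ge_0[OF i] i assms(4,9) P_carrier[of s t]
        by (cases "vector_polar m I g (dual_arg A H c s t) $ i") auto
    qed
    moreover have "0 \<le> (p - H *\<^sub>v y - K *\<^sub>v ?G y) \<bullet> t"
    proof (rule scalar_prod_nonneg[OF tc])
      fix i assume i: "i < l"
      show "0 \<le> t $ i" using t0 i tc by (auto simp: less_eq_vec_def)
      show "0 \<le> (p - H *\<^sub>v y - K *\<^sub>v ?G y) $ i"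
        using ineq i assms(6,8,9) by (auto simp: less_eq_vec_def diff_diff_eq)
    qed
    moreover have "dual_arg A H c s t \<bullet> y \<le> ?P s t \<bullet> ?G y"
      by (rule vector_gauge_polar_cauchy_schwarz[OF assms(1,2) dom finite])
    ultimately show ?thesis using gap[OF Ay yc sc tc] by linarith
  qed
  \<comment> \<open>Complementarity makes every summand vanish, here and in the next product;
    alignment removes the third term of the gap.\<close>
  have "(d + K\<^sup>T *\<^sub>v v - ?P u v) \<bullet> ?G x = 0"
    unfolding scalar_prod_def using complementarity_gauge
    by (intro sum.neutral) (simp add: vector_gauge_def)
  moreover have "(p - H *\<^sub>v x - K *\<^sub>v ?G x) \<bullet> v = 0"
    unfolding scalar_prod_def using complementarity_ineq assms(12)
    by (intro sum.neutral) simp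
  moreover have "A *\<^sub>v x = b"
    using primal_feasibility by (simp add: primal_feasible_def)
  ultimately have strong: "primal_objective m I g c d x = dual_objective b p (u, v)"
    using gap[of x u v] assms(10-12) alignment by simp
  \<comment> \<open>By weak duality against the fixed dual point, the common value bounds all primal
    values from below; the dual claim is symmetric.\<close>
  have "is_arg_min (primal_objective m I g c d) (primal_feasible n m I g A b H K p) x"
    using weak[OF _ dual_feasibility] primal_feasibility
    by (auto simp: is_arg_min_def strong not_less)
  moreover have
    "is_arg_max (dual_objective b p) (dual_feasible m k l I g A H K c d) (u, v)"
    using weak[OF primal_feasibility] dual_feasibility
    by (auto simp: is_arg_max_def strong[symmetric] not_less)
  ultimately show ?thesis ..
qed

end
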